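(* Let $\mu,\nu,t\in\mathbb{C}$ with $\Re(\mu+\nu)>-1$, and let $r_N,\bar r_N$ ($N\ge0$) be the reflection coefficients of the weight $w(z)=(1+z)^{\mu}(1+1/z)^{\nu}e^{tz}$ on the unit circle, where it is assumed that the Toeplitz determinants $I^0_N[w]$ are nonzero for all $N\ge1$. Put $v_N=1-r_N\bar r_N$. Then for all $N\ge1$ $$(N+\nu)\sum_{j=0}^{N-1}\bar r_{j+1}r_j-t\sum_{j=0}^{N-1}r_{j+1}\bar r_j=-(\mu+t)N,$$ and the Adler–van Moerbeke recurrences $$-t\,r_{N+1}\bar r_N+t\,r_N\bar r_{N-1}+(N+1+\nu)r_N\bar r_{N+1}-(N-1+\nu)r_{N-1}\bar r_N=0,$$ $$v_{N+1}\big[N+1+\nu+t\,r_{N+2}\bar r_N\big]-v_N\big[N+\nu+t\,r_{N+1}\bar r_{N-1}\big]+r_{N+1}\bar r_N=1$$ hold.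
   Context: On the unit circle, $w(e^{i\theta})=e^{i\theta(\mu-\nu)/2}\,|1+e^{i\theta}|^{\mu+\nu}\,e^{te^{i\theta}}$ for $-\pi<\theta\le\pi$ (principal branches). Its Fourier coefficients are $w_k=\frac1{2\pi}\int_{-\pi}^{\pi}w(e^{i\theta})e^{-ik\theta}\,d\theta$, $k\in\mathbb{Z}$. For $\epsilon\in\{0,1,-1\}$ put $I^\epsilon_N[w]=\det[w_{-\epsilon+j-k}]_{0\le j,k\le N-1}$, $I^\epsilon_0[w]=1$. The reflection coefficients are $r_N=(-1)^N I^1_N[w]/I^0_N[w]$ and $\bar r_N=(-1)^N I^{-1}_N[w]/I^0_N[w]$ (so $r_0=\bar r_0=1$); these are in general two independent quantities and the bar does not mean complex conjugation. *)

theory Defs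
  imports "HOL-Analysis.Analysis" "Jordan_Normal_Form.Determinant"
begin

(* powr takes the principal branch of both factors; at z = -1 the value is 0,
   which is irrelevant for the Fourier coefficients. *)
definition circle_weight :: "complex \<Rightarrow> complex \<Rightarrow> complex \<Rightarrow> complex \<Rightarrow> complex" where
  "circle_weight \<mu> \<nu> t z = (1 + z) powr \<mu> * (1 + 1 / z) powr \<nu> * exp (t * z)"

lemma circle_weight_cis:
  fixes \<mu> \<nu> t :: complex and \<theta> :: real
  assumes "- pi < \<theta>" "\<theta> \<le> pi"
  shows "circle_weight \<mu> \<nu> t (cis \<theta>) =
    exp (\<i> * of_real \<theta> * (\<mu> - \<nu>) / 2) * of_real (cmod (1 + cis \<theta>)) powr (\<mu> + \<nu>)
      * exp (t * cis \<theta>)"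
proof (cases "\<theta> = pi")
  case True
  then show ?thesis by (simp add: circle_weight_def)
next
  case False
  define c where "c = 2 * cos (\<theta> / 2)"
  have c: "c > 0" using assms False by (auto simp: c_def intro!: cos_gt_zero_pi)
  have polar: "1 + cis \<phi> = exp (Complex (ln c) (\<phi> / 2))"
    if "\<phi> = \<theta> \<or> \<phi> = - \<theta>" for \<phi>
  proof -
    have "c = 2 * cos (\<phi> / 2)" using that by (auto simp: c_def)
    moreover have "cos \<phi> = 2 * (cos (\<phi> / 2))\<^sup>2 - 1" "sin \<phi> = 2 * sin (\<phi> / 2) * cos (\<phi> / 2)"
      using cos_double_cos[of "\<phi> / 2"] sin_double[of "\<phi> / 2"] by simp_all
    ultimately have "1 + cis \<phi> = of_real c * cis (\<phi> / 2)"
      by (simp add: complex_eq_iff power2_eq_square)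
    then show ?thesis using c by (simp add: exp_eq_polar exp_of_real)
  qed
  have Ln: "Ln (1 + cis \<phi>) = Complex (ln c) (\<phi> / 2)" if "\<phi> = \<theta> \<or> \<phi> = - \<theta>" for \<phi>
    unfolding polar[OF that] using that assms False by (intro Ln_exp) auto
  have nz: "1 + cis \<phi> \<noteq> 0" if "\<phi> = \<theta> \<or> \<phi> = - \<theta>" for \<phi>
    unfolding polar[OF that] by simp
  have norm: "cmod (1 + cis \<theta>) = c"
    using c by (simp add: polar norm_exp_eq_Re)
  have "1 / cis \<theta> = cis (- \<theta>)" by (simp add: divide_inverse)
  then have "circle_weight \<mu> \<nu> t (cis \<theta>) =
      exp (\<mu> * Complex (ln c) (\<theta> / 2) + \<nu> * Complex (ln c) (- \<theta> / 2)) * exp (t * cis \<theta>)"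
    using Ln[of \<theta>] Ln[of "- \<theta>"] nz[of \<theta>] nz[of "- \<theta>"]
    by (simp add: circle_weight_def powr_def exp_add)
  also have "\<mu> * Complex (ln c) (\<theta> / 2) + \<nu> * Complex (ln c) (- \<theta> / 2) =
      \<i> * of_real \<theta> * (\<mu> - \<nu>) / 2 + (\<mu> + \<nu>) * of_real (ln c)"
    by (simp add: Complex_eq field_simps)
  also have "exp \<dots> = exp (\<i> * of_real \<theta> * (\<mu> - \<nu>) / 2)
      * of_real (cmod (1 + cis \<theta>)) powr (\<mu> + \<nu>)"
    using c by (simp add: norm powr_def exp_add Ln_of_real)
  finally show ?thesis .
qed

definition fourier_coeff :: "(complex \<Rightarrow> complex) \<Rightarrow> int \<Rightarrow> complex" where
  "fourier_coeff w k =
     1 / (2 * of_real pi) *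
     integral {- pi..pi} (\<lambda>\<theta>. w (cis \<theta>) * exp (- (\<i> * of_int k * of_real \<theta>)))"


definition toeplitz_det :: "(complex \<Rightarrow> complex) \<Rightarrow> int \<Rightarrow> nat \<Rightarrow> complex" where
  "toeplitz_det w \<epsilon> N =
     Determinant.det (Matrix.mat N N (\<lambda>(j, k). fourier_coeff w (- \<epsilon> + int j - int k)))"

lemma toeplitz_det_0: "toeplitz_det w \<epsilon> 0 = 1"
  by (simp add: toeplitz_det_def)

definition refl_coeff :: "(complex \<Rightarrow> complex) \<Rightarrow> nat \<Rightarrow> complex" where
  "refl_coeff w N = (- 1) ^ N * toeplitz_det w 1 N / toeplitz_det w 0 N"

(* The bar is part of the name and does not denote complex conjugation. *)
definition refl_coeff_bar :: "(complex \<Rightarrow> complex) \<Rightarrow> nat \<Rightarrow> complex" where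
  "refl_coeff_bar w N = (- 1) ^ N * toeplitz_det w (- 1) N / toeplitz_det w 0 N"

end

theory Submission
  imports Defs
begin

text \<open>
  Integrating the derivative of \<open>(1 + z) w(z) z^(-k)\<close> over the circle gives
  \<open>(k + \<nu>) w\<^sub>k + (k - 1 - \<mu> - t) w\<^sub>k\<^sub>-\<^sub>1 - t w\<^sub>k\<^sub>-\<^sub>2 = 0\<close>, hence a Pearson-type relation for the
  bilinear form \<open>(z^a, z^(-b)) \<mapsto> w\<^sub>b\<^sub>-\<^sub>a\<close>. Its monic biorthogonal polynomials \<open>\<phi>\<^sub>n\<close>, \<open>\<psi>\<^sub>n\<close> have constant terms
  \<open>r\<^sub>n\<close>, \<open>rbar\<^sub>n\<close> and satisfy the Szego recurrence, so their norms have ratio \<open>h\<^sub>n\<^sub>+\<^sub>1 / h\<^sub>n = v\<^sub>n\<^sub>+\<^sub>1\<close>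
  and their subleading coefficients are partial sums of products of reflection coefficients. The Pearson relation at
  \<open>(\<phi>\<^sub>n, \<psi>\<^sub>n)\<close> is the difference in \<open>n\<close> of the first identity, and its own difference is the first
  recurrence; at \<open>(\<phi>\<^sub>n\<^sub>+\<^sub>1, \<psi>\<^sub>n)\<close> it is the summed form of the second recurrence.
\<close>

section \<open>Bilinear forms on polynomials\<close>

definition pairing :: "(nat \<Rightarrow> 'a::field) \<Rightarrow> 'a poly \<Rightarrow> 'a" where
  "pairing f p = (\<Sum>i\<le>degree p. coeff p i * f i)"

lemma pairing_eq_sum: "degree p \<le> n \<Longrightarrow> pairing f p = (\<Sum>i\<le>n. coeff p i * f i)"
  unfolding pairing_def by (rule sum.mono_neutral_left) (auto simp: coeff_eq_0)

lemma pairing_add [simp]: "pairing f (p + q) = pairing f p + pairing f q"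
proof -
  let ?n = "max (degree p) (degree q)"
  have "degree (p + q) \<le> ?n" by (rule degree_add_le_max)
  then show ?thesis
    by (simp add: pairing_eq_sum[of _ ?n] sum.distrib algebra_simps)
qed

lemma pairing_0 [simp]: "pairing f 0 = 0"
  by (simp add: pairing_def)

lemma pairing_smult [simp]: "pairing f (Polynomial.smult c p) = c * pairing f p"
  using pairing_eq_sum[of "Polynomial.smult c p" "degree p" f, OF degree_smult_le]
  by (simp add: pairing_def sum_distrib_left mult.assoc)

lemma pairing_diff [simp]: "pairing f (p - q) = pairing f p - pairing f q"
  using pairing_add[of f "p - q" q] by simp

lemma pairing_pCons: "pairing f (pCons c p) = c * f 0 + pairing (\<lambda>i. f (Suc i)) p"
proof -
  have "degree (pCons c p) \<le> Suc (degree p)" by (rule degree_pCons_le)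
  then have "pairing f (pCons c p) = (\<Sum>i\<le>Suc (degree p). coeff (pCons c p) i * f i)"
    by (rule pairing_eq_sum)
  also have "\<dots> = c * f 0 + pairing (\<lambda>i. f (Suc i)) p"
    unfolding sum.atMost_Suc_shift by (simp add: pairing_def)
  finally show ?thesis .
qed

text \<open>At \<open>i = 0\<close> truncated subtraction shifts the index, but the factor
  \<open>of_nat i\<close> vanishes there.\<close>

lemma of_nat_mult_pred: "of_nat i * f (Suc (i - 1)) = of_nat i * f i"
  by (cases i) simp_all

lemma pairing_pderiv: "pairing f (pderiv p) = pairing (\<lambda>i. of_nat i * f (i - 1)) p"
proof (induction p arbitrary: f)
  case 0
  show ?case by simp
next
  case (pCons c p)
  show ?case
    unfolding pderiv_pCons pairing_add pairing_pCons pCons.IH of_nat_mult_pred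
    by (simp add: pairing_def sum.distrib [symmetric] algebra_simps)
qed

lemma pairing_pCons_0_pderiv:
  "pairing f (pCons 0 (pderiv p)) = pairing (\<lambda>i. of_nat i * f i) p"
  unfolding pairing_pCons pairing_pderiv of_nat_mult_pred by simp

section \<open>Bilinear forms given by a double sequence\<close>

definition pair2 :: "(nat \<Rightarrow> nat \<Rightarrow> 'a::field) \<Rightarrow> 'a poly \<Rightarrow> 'a poly \<Rightarrow> 'a" where
  "pair2 F p q = pairing (\<lambda>b. pairing (\<lambda>a. F a b) p) q"

lemma pairing_add_fun: "pairing (\<lambda>i. f i + g i) p = pairing f p + pairing g p"
  by (simp add: pairing_def sum.distrib algebra_simps)

lemma pairing_mult_fun: "pairing (\<lambda>i. c * f i) p = c * pairing f p"
  by (simp add: pairing_def sum_distrib_left algebra_simps)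

lemma pairing_diff_fun: "pairing (\<lambda>i. f i - g i) p = pairing f p - pairing g p"
  by (simp add: pairing_def sum_subtractf algebra_simps)

lemma pair2_swap: "pair2 F p q = pair2 (\<lambda>b a. F a b) q p"
  unfolding pair2_def pairing_def sum_distrib_left
  by (subst sum.swap) (simp add: mult.left_commute)

lemma pairing_triangular:
  assumes "\<And>b. b < n \<Longrightarrow> f b = 0" "degree q \<le> n"
  shows "pairing f q = coeff q n * f n"
  unfolding pairing_eq_sum[OF assms(2)] using assms(1)
  by (simp add: sum.remove[of _ n])

text \<open>On monomials this is \<open>(z^a, u^b) \<mapsto> w (b - a)\<close>; think of \<open>u\<close> as \<open>1/z\<close>.\<close>
definition toep_form :: "(int \<Rightarrow> 'a::field) \<Rightarrow> 'a poly \<Rightarrow> 'a poly \<Rightarrow> 'a" where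
  "toep_form w = pair2 (\<lambda>a b. w (int b - int a))"

abbreviation flip :: "(int \<Rightarrow> 'a) \<Rightarrow> int \<Rightarrow> 'a" where
  "flip w \<equiv> \<lambda>k. w (- k)"

text \<open>Exchanging \<open>z\<close> and \<open>u\<close> reverses the index of \<open>w\<close>;
  results on \<open>biorth w\<close> thereby transfer to \<open>biorth (flip w)\<close>.\<close>

lemma toep_form_flip: "toep_form w p q = toep_form (flip w) q p"
  unfolding toep_form_def by (subst pair2_swap) simp

text \<open>By bilinearity monomials \<open>z^a\<close>, \<open>u^b\<close> suffice; there the
  identity is, up to sign, the recurrence for \<open>w\<close> at
  \<open>k = b - a + 1\<close>.\<close>

lemma pearson:
  fixes w :: "int \<Rightarrow> 'a::field"
  assumes "\<And>k. (of_int k + \<nu>) * w k + (of_int k - 1 - \<mu> - t) * w (k - 1) - t * w (k - 2) = 0"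
  defines "B \<equiv> toep_form w"
  shows "B (pCons 0 (pderiv p)) q - B p (pCons 0 (pderiv q)) + B (pderiv p) q
    - B p (pCons 0 (pCons 0 (pderiv q)))
    = (\<nu> + 1) * B p (pCons 0 q) - (\<mu> + t) * B p q - t * B (pCons 0 p) q"
proof -
  have pw: "of_nat a * w (int b - int a) - of_nat b * w (int b - int a)
     + of_nat a * w (int b - int (a - 1)) - of_nat b * w (int (Suc b) - int a)
    - (\<nu> + 1) * w (int (Suc b) - int a) + (\<mu> + t) * w (int b - int a) + t * w (int b - int (Suc a)) = 0" for a b
  proof -
    have "of_nat a * w (int b - int (a - 1)) = of_nat a * w (int (Suc b) - int a)"
      by (cases a) simp_all
    then show ?thesis
      using assms(1)[of "int b - int a + 1"] by (simp add: algebra_simps)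
  qed
  have "B (pCons 0 (pderiv p)) q - B p (pCons 0 (pderiv q)) + B (pderiv p) q
    - B p (pCons 0 (pCons 0 (pderiv q)))
    - (\<nu> + 1) * B p (pCons 0 q) + (\<mu> + t) * B p q + t * B (pCons 0 p) q
    = pair2 (\<lambda>a b. of_nat a * w (int b - int a) - of_nat b * w (int b - int a)
     + of_nat a * w (int b - int (a - 1)) - of_nat b * w (int (Suc b) - int a)
    - (\<nu> + 1) * w (int (Suc b) - int a) + (\<mu> + t) * w (int b - int a) + t * w (int b - int (Suc a))) p q"
    (is "?l = ?r")
    unfolding B_def toep_form_def pair2_def
    unfolding pairing_pCons[where p = "pCons 0 (pderiv r)" for r] pairing_pCons_0_pderiv
    by (simp only: pairing_pderiv pairing_pCons mult_zero_left add_0_left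
      pairing_add_fun pairing_diff_fun pairing_mult_fun)
  also have "\<dots> = 0"
    unfolding pw by (simp add: pair2_def pairing_def)
  finally show ?thesis by (simp add: algebra_simps)
qed

section \<open>Biorthogonal polynomials of a Toeplitz form\<close>

definition toep_mat :: "(int \<Rightarrow> 'a) \<Rightarrow> int \<Rightarrow> nat \<Rightarrow> 'a Matrix.mat" where
  "toep_mat w e n = Matrix.mat n n (\<lambda>(j, k). w (- e + int j - int k))"

lemma toep_mat_carrier [simp]: "toep_mat w e n \<in> carrier_mat n n"
  by (simp add: toep_mat_def)

text \<open>Reversing the index of \<open>w\<close> transposes the Toeplitz matrix and negates the
  offset, so the barred coefficients are those of \<open>flip w\<close>.\<close>

lemma det_toep_mat_flip: "Determinant.det (toep_mat (flip w) e n) = Determinant.det (toep_mat w (- e) n)"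
proof -
  have "toep_mat (flip w) e n = Matrix.transpose_mat (toep_mat w (- e) n)"
    by (rule eq_matI) (auto simp: toep_mat_def algebra_simps)
  then show ?thesis by (simp add: Determinant.det_transpose[OF toep_mat_carrier])
qed

text \<open>The biorthogonal system consists of \<open>biorth w n\<close> (in \<open>z\<close>) and \<open>biorth (flip w) n\<close> (in \<open>u\<close>);
  the numbers \<open>toep_norm w n\<close> are the common norms.\<close>
definition biorth :: "(int \<Rightarrow> 'a::field) \<Rightarrow> nat \<Rightarrow> 'a poly" where
  "biorth w n = (\<Sum>a\<le>n. Polynomial.monom (Determinant.cofactor (toep_mat w 0 (Suc n)) n a
     / Determinant.det (toep_mat w 0 n)) a)"

definition toep_norm :: "(int \<Rightarrow> 'a::field) \<Rightarrow> nat \<Rightarrow> 'a" where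
  "toep_norm w n = Determinant.det (toep_mat w 0 (Suc n)) / Determinant.det (toep_mat w 0 n)"

definition szego_coeff :: "(int \<Rightarrow> 'a::field) \<Rightarrow> nat \<Rightarrow> 'a" where
  "szego_coeff w n = (- 1) ^ n * Determinant.det (toep_mat w 1 n) / Determinant.det (toep_mat w 0 n)"

lemma toep_norm_flip: "toep_norm (flip w) n = toep_norm w n"
  by (simp add: toep_norm_def det_toep_mat_flip)

lemma coeff_biorth: "coeff (biorth w n) a = (if a \<le> n then
   Determinant.cofactor (toep_mat w 0 (Suc n)) n a / Determinant.det (toep_mat w 0 n) else 0)"
  by (simp add: biorth_def coeff_sum)

lemma degree_biorth_le: "degree (biorth w n) \<le> n"
  by (rule degree_le) (simp add: coeff_biorth)

text \<open>The pairing of \<open>p\<close> with \<open>u^k\<close>. Integer \<open>k\<close> makes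
  multiplication by \<open>z\<close> and reversal plain changes of index.\<close>

definition moment :: "(int \<Rightarrow> 'a::field) \<Rightarrow> 'a poly \<Rightarrow> int \<Rightarrow> 'a" where
  "moment w p k = pairing (\<lambda>a. w (k - int a)) p"

lemma toep_form_moment: "toep_form w p q = pairing (\<lambda>b. moment w p (int b)) q"
  by (simp add: toep_form_def pair2_def moment_def)

text \<open>Pairing with \<open>u^b\<close> puts row \<open>b\<close> in place of the last row of
  the defining determinant, which then has two equal rows unless \<open>b = n\<close>. Formally this
  is column \<open>n\<close> of \<open>A * adj_mat A\<close>.\<close>

lemma moment_biorth:
  assumes "b \<le> n"
  shows "moment w (biorth w n) (int b) = (if b = n then toep_norm w n else 0)"
proof -
  define A where "A = toep_mat w 0 (Suc n)"
  have A: "A \<in> carrier_mat (Suc n) (Suc n)" by (simp add: A_def)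
  have "moment w (biorth w n) (int b) =
     (\<Sum>a\<le>n. A $$ (b, a) * Determinant.cofactor A n a) / Determinant.det (toep_mat w 0 n)"
    using assms unfolding moment_def pairing_eq_sum[OF degree_biorth_le]
    by (simp add: coeff_biorth A_def toep_mat_def sum_divide_distrib mult.commute)
  also have "(\<Sum>a\<le>n. A $$ (b, a) * Determinant.cofactor A n a) = (A * adj_mat A) $$ (b, n)"
    using A assms by (auto simp: scalar_prod_def adj_mat_def atLeast0LessThan lessThan_Suc_atMost)
  also have "\<dots> = (if b = n then Determinant.det A else 0)"
    using assms adj_mat(2)[OF A] by simp
  finally show ?thesis by (simp add: toep_norm_def A_def)
qed

definition regular_symbol :: "(int \<Rightarrow> 'a::field) \<Rightarrow> bool" where
  "regular_symbol w \<longleftrightarrow> (\<forall>n. Determinant.det (toep_mat w 0 n) \<noteq> 0)"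

lemma regular_symbol_flip: "regular_symbol w \<Longrightarrow> regular_symbol (flip w)"
  by (simp add: regular_symbol_def det_toep_mat_flip)

lemma toep_norm_nonzero: "regular_symbol w \<Longrightarrow> toep_norm w n \<noteq> 0"
  by (simp add: regular_symbol_def toep_norm_def)

lemma coeff_biorth_top:
  assumes "regular_symbol w"
  shows "coeff (biorth w n) n = 1"
proof -
  have "mat_delete (toep_mat w 0 (Suc n)) n n = toep_mat w 0 n"
    by (rule eq_matI) (auto simp: toep_mat_def mat_delete_def)
  then show ?thesis
    using assms by (simp add: coeff_biorth Determinant.cofactor_def regular_symbol_def)
qed

lemma degree_biorth:
  assumes "regular_symbol w"
  shows "degree (biorth w n) = n"
  using degree_biorth_le[of w n] le_degree[of "biorth w n" n] coeff_biorth_top[OF assms] by simp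

text \<open>Deleting the last row and the first column leaves a Toeplitz matrix with all indices
  lowered by one; the cofactor sign is \<open>(-1)^n\<close>.\<close>

lemma coeff_biorth_0: "coeff (biorth w n) 0 = szego_coeff w n"
proof -
  have "mat_delete (toep_mat w 0 (Suc n)) n 0 = toep_mat w 1 n"
    by (rule eq_matI) (auto simp: toep_mat_def mat_delete_def algebra_simps)
  then show ?thesis
    by (simp add: coeff_biorth szego_coeff_def Determinant.cofactor_def)
qed

lemma toep_form_biorth_left:
  assumes "degree q \<le> n"
  shows "toep_form w (biorth w n) q = coeff q n * toep_norm w n"
  unfolding toep_form_moment
  by (subst pairing_triangular[OF _ assms]) (simp_all add: moment_biorth)

lemma toep_form_biorth_right:
  assumes "degree p \<le> n"
  shows "toep_form w p (biorth (flip w) n) = coeff p n * toep_norm w n"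
  using toep_form_biorth_left[OF assms, of "flip w"]
  by (simp add: toep_form_flip[of w] toep_norm_flip)

text \<open>The Toeplitz property: entries depend only on \<open>b - a\<close>, so the factors
  \<open>z\<close> and \<open>u\<close> cancel.\<close>

lemma toep_form_pCons_0: "toep_form w (pCons 0 p) (pCons 0 q) = toep_form w p q"
  by (simp add: toep_form_def pair2_def pairing_pCons)

lemma toep_form_add_left: "toep_form w (p + p') q = toep_form w p q + toep_form w p' q"
  by (simp add: toep_form_def pair2_def pairing_add_fun)

lemma toep_form_diff_left: "toep_form w (p - p') q = toep_form w p q - toep_form w p' q"
  by (simp add: toep_form_def pair2_def pairing_diff_fun)

lemma toep_form_smult_left: "toep_form w (Polynomial.smult c p) q = c * toep_form w p q"
  by (simp add: toep_form_def pair2_def pairing_mult_fun)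

lemma toep_form_add_right: "toep_form w p (q + q') = toep_form w p q + toep_form w p q'"
  by (simp add: toep_form_def pair2_def)

lemma toep_form_smult_right: "toep_form w p (Polynomial.smult c q) = c * toep_form w p q"
  by (simp add: toep_form_def pair2_def)

section \<open>Reversed polynomials and the Szego recurrence\<close>

lemma pairing_reflect: "pairing f (reflect_poly p) = pairing (\<lambda>i. f (degree p - i)) p"
proof -
  have "degree (reflect_poly p) \<le> degree p" by (rule degree_reflect_poly_le)
  then have "pairing f (reflect_poly p) = (\<Sum>i\<le>degree p. coeff p (degree p - i) * f i)"
    by (simp add: pairing_eq_sum coeff_reflect_poly)
  also have "\<dots> = (\<Sum>i\<le>degree p. coeff p i * f (degree p - i))"
    by (rule sum.reindex_bij_witness[of _ "\<lambda>i. degree p - i" "\<lambda>i. degree p - i"]) auto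
  finally show ?thesis by (simp add: pairing_def)
qed

lemma moment_reflect:
  "moment w (reflect_poly p) k = moment (flip w) p (int (degree p) - k)"
  unfolding moment_def pairing_reflect unfolding pairing_def
  by (intro sum.cong refl arg_cong2[where f = "(*)"]) (auto simp: of_nat_diff algebra_simps)

lemma pairing_lowest:
  assumes "\<And>b. 0 < b \<Longrightarrow> b \<le> n \<Longrightarrow> f b = 0" "degree q \<le> n"
  shows "pairing f q = coeff q 0 * f 0"
  unfolding pairing_eq_sum[OF assms(2)] using assms(1)
  by (subst sum.remove[of _ 0]) simp_all

text \<open>The reversed polynomial \<open>z^n \<psi>_n(1/z)\<close> of Szego theory, where
  \<open>\<psi>_n\<close> is \<open>biorth (flip w) n\<close>.\<close>

definition dual_biorth :: "(int \<Rightarrow> 'a::field) \<Rightarrow> nat \<Rightarrow> 'a poly" where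
  "dual_biorth w n = reflect_poly (biorth (flip w) n)"

lemma moment_dual_biorth:
  assumes "regular_symbol w" "b \<le> n"
  shows "moment w (dual_biorth w n) (int b) = (if b = 0 then toep_norm w n else 0)"
proof -
  have "int n - int b = int (n - b)" using assms(2) by simp
  then show ?thesis
    using moment_biorth[of "n - b" n "flip w"] assms
    by (auto simp: dual_biorth_def moment_reflect degree_biorth regular_symbol_flip toep_norm_flip)
qed

lemma toep_form_dual_biorth:
  assumes "regular_symbol w" "degree q \<le> n"
  shows "toep_form w (dual_biorth w n) q = coeff q 0 * toep_norm w n"
  unfolding toep_form_moment
  by (subst pairing_lowest[OF _ assms(2)]) (simp_all add: moment_dual_biorth[OF assms(1)]
    moment_dual_biorth[OF assms(1), of 0, simplified])

lemma coeff_dual_biorth: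
  assumes "regular_symbol w"
  shows "coeff (dual_biorth w n) i = (if i \<le> n then coeff (biorth (flip w) n) (n - i) else 0)"
  using assms by (simp add: dual_biorth_def coeff_reflect_poly degree_biorth regular_symbol_flip)

lemma moment_diff: "moment w (p - q) k = moment w p k - moment w q k"
  by (simp add: moment_def)

lemma moment_smult: "moment w (Polynomial.smult c p) k = c * moment w p k"
  by (simp add: moment_def)

lemma moment_pCons_0: "moment w (pCons 0 p) k = moment w p (k - 1)"
  by (simp add: moment_def pairing_pCons algebra_simps)

text \<open>Pairing \<open>p\<close> with the dual polynomial of the same degree isolates the
  leading coefficient times a nonzero norm.\<close>

lemma poly_eq_0_if_moments:
  assumes "regular_symbol w" and "\<And>b. b \<le> degree p \<Longrightarrow> moment w p (int b) = 0"
  shows "p = 0"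
proof -
  define n where "n = degree p"
  have "lead_coeff p * toep_norm w n = toep_form w p (biorth (flip w) n)"
    by (simp add: toep_form_biorth_right n_def)
  also have "\<dots> = (\<Sum>b\<le>n. coeff (biorth (flip w) n) b * moment w p (int b))"
    unfolding toep_form_moment by (rule pairing_eq_sum[OF degree_biorth_le])
  also have "\<dots> = 0"
    using assms(2) by (simp add: n_def)
  finally show ?thesis
    using toep_norm_nonzero[OF assms(1)] by simp
qed

lemma szego_recurrence:
  assumes "regular_symbol w"
  shows "biorth w (Suc n) =
    pCons 0 (biorth w n) + Polynomial.smult (szego_coeff w (Suc n)) (dual_biorth w n)"
proof -
  \<comment> \<open>The leading terms cancel and so do the constant terms, since the reversed
    polynomial has constant term 1. Moments 1 to \<open>n\<close> of \<open>p\<close> vanish too, so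
    dividing by \<open>z\<close> leaves a polynomial of degree below \<open>n\<close> with moments 0
    to \<open>n - 1\<close> zero.\<close>
  define p where "p = biorth w (Suc n) - pCons 0 (biorth w n)
    - Polynomial.smult (szego_coeff w (Suc n)) (dual_biorth w n)"
  have p0: "coeff p 0 = 0"
    using assms by (simp add: p_def coeff_biorth_0 coeff_dual_biorth coeff_biorth_top regular_symbol_flip)
  have deg: "degree p \<le> n"
  proof (rule degree_le, intro allI impI)
    fix i assume "n < i"
    then show "coeff p i = 0"
      using assms
      by (cases "i = Suc n")
        (auto simp: p_def coeff_pCons coeff_biorth_top coeff_dual_biorth
          coeff_eq_0 degree_biorth split: nat.split)
  qed
  have m: "moment w p (int (Suc b)) = 0" if "b < n" for b
    using that assms moment_biorth[of "Suc b" "Suc n" w] moment_biorth[of b n w]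
      moment_dual_biorth[of w "Suc b" n]
    by (simp add: p_def moment_diff moment_smult moment_pCons_0)
  obtain q where q: "p = pCons 0 q"
    using p0 by (cases p) auto
  have "q = 0"
  proof (rule ccontr)
    assume "q \<noteq> 0"
    then have "degree q < n" using deg by (simp add: q)
    then have "q = 0"
      using m by (intro poly_eq_0_if_moments[OF assms]) (simp add: q moment_pCons_0)
    with \<open>q \<noteq> 0\<close> show False by simp
  qed
  then have "p = 0" by (simp add: q)
  then show ?thesis by (simp add: p_def diff_diff_eq)
qed

section \<open>Shifts, norms and subleading coefficients\<close>

lemma toep_form_shift_left:
  assumes "regular_symbol w" "degree q \<le> n"
  shows "toep_form w (pCons 0 (biorth w n)) q = - szego_coeff w (Suc n) * coeff q 0 * toep_norm w n"
proof -
  \<comment> \<open>The first term is orthogonal to degree at most \<open>n\<close>, and the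
    reversed polynomial sees only the constant term of \<open>q\<close>.\<close>
  have "pCons 0 (biorth w n) = biorth w (Suc n)
      - Polynomial.smult (szego_coeff w (Suc n)) (dual_biorth w n)"
    using szego_recurrence[OF assms(1), of n] by simp
  moreover have "coeff q (Suc n) = 0"
    using assms(2) by (simp add: coeff_eq_0)
  ultimately show ?thesis
    using assms
    by (simp add: toep_form_diff_left toep_form_smult_left toep_form_biorth_left toep_form_dual_biorth)
qed

lemma toep_form_shift_right:
  assumes "regular_symbol w" "degree p \<le> n"
  shows "toep_form w p (pCons 0 (biorth (flip w) n))
    = - szego_coeff (flip w) (Suc n) * coeff p 0 * toep_norm w n"
  using toep_form_shift_left[OF regular_symbol_flip[OF assms(1)] assms(2)]
  by (simp add: toep_form_flip[of w] toep_norm_flip)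

lemma toep_norm_Suc:
  assumes "regular_symbol w"
  shows "toep_norm w (Suc n) =
    toep_norm w n * (1 - szego_coeff w (Suc n) * szego_coeff (flip w) (Suc n))"
proof -
  let ?p = "biorth w n" and ?q = "biorth (flip w) n"
  note reg = assms regular_symbol_flip[OF assms]
  \<comment> \<open>\<open>pCons 0 ?q\<close> is monic of degree \<open>n + 1\<close>, so it may
    replace the dual polynomial of that degree in the norm.\<close>
  have "toep_norm w (Suc n) = toep_form w (biorth w (Suc n)) (pCons 0 ?q)"
    using reg degree_biorth_le[of "flip w" n]
    by (subst toep_form_biorth_left) (auto simp: degree_pCons_eq_if coeff_biorth_top)
  also have "\<dots> = toep_form w ?p ?q + szego_coeff w (Suc n) * toep_form w (dual_biorth w n) (pCons 0 ?q)"
    using reg by (simp add: szego_recurrence toep_form_add_left toep_form_smult_left toep_form_pCons_0)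
  also have "toep_form w ?p ?q = toep_norm w n"
    using reg by (simp add: toep_form_biorth_left degree_biorth_le coeff_biorth_top)
  also have "toep_form w (dual_biorth w n) (pCons 0 ?q)
      = - szego_coeff (flip w) (Suc n) * toep_norm w n"
    using reg
    by (subst toep_form_shift_right)
      (auto simp: coeff_dual_biorth coeff_biorth_top intro!: degree_le)
  finally show ?thesis by (simp add: algebra_simps)
qed

text \<open>The Szego recurrence adds the constant term of the dual polynomial at each step. The
  extra factor \<open>z\<close> replaces the index \<open>n - 1\<close> and gives 0 at
  \<open>n = 0\<close>.\<close>

lemma coeff_biorth_subleading:
  assumes "regular_symbol w"
  shows "coeff (pCons 0 (biorth w n)) n
    = (\<Sum>j<n. szego_coeff w (Suc j) * szego_coeff (flip w) j)"
proof (induction n)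
  case 0
  show ?case by simp
next
  case (Suc n)
  have "coeff (pCons 0 (biorth w (Suc n))) (Suc n)
    = coeff (pCons 0 (biorth w n)) n + szego_coeff w (Suc n) * coeff (dual_biorth w n) n"
    by (simp add: szego_recurrence[OF assms])
  then show ?case
    using assms by (simp add: Suc coeff_dual_biorth coeff_biorth_0)
qed

section \<open>The Euler operator z d/dz on coefficients\<close>

lemma coeff_pCons_0_euler:
  fixes p :: "'a::field poly"
  shows "coeff (pCons 0 (pCons 0 (pderiv p))) n = (of_nat n - 1) * coeff (pCons 0 p) n"
  by (cases n) (auto simp: coeff_pCons coeff_pderiv split: nat.split)

lemma coeff_euler:
  fixes p :: "'a::field poly"
  shows "coeff (pCons 0 (pderiv p)) n = of_nat n * coeff p n"
  by (cases n) (auto simp: coeff_pderiv)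

lemma degree_euler_le: "degree (pCons 0 (pderiv p)) \<le> degree (p :: 'a::field poly)"
  by (rule degree_le) (simp add: coeff_euler coeff_eq_0)


lemma degree_pderiv_le: "degree (pderiv p) \<le> degree (p :: 'a::field poly) - 1"
  by (rule degree_le) (simp add: coeff_pderiv coeff_eq_0)

section \<open>Consequences of the Pearson relation\<close>

text \<open>A purely algebraic setting: of the weight only nonvanishing determinants and the
  three-term relation are retained.\<close>

locale semiclassical_symbol =
  fixes w :: "int \<Rightarrow> 'a::field" and \<mu> \<nu> t :: 'a
  assumes reg: "regular_symbol w"
    and rec: "\<And>k. (of_int k + \<nu>) * w k + (of_int k - 1 - \<mu> - t) * w (k - 1) - t * w (k - 2) = 0"
begin

abbreviation "r \<equiv> szego_coeff w"
abbreviation "rb \<equiv> szego_coeff (flip w)"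
abbreviation "\<phi> \<equiv> biorth w"
abbreviation "\<psi> \<equiv> biorth (flip w)"
abbreviation "h \<equiv> toep_norm w"
abbreviation "B \<equiv> toep_form w"

lemmas regular_flip = regular_symbol_flip[OF reg]

lemmas ortho_simps = toep_form_biorth_left toep_form_biorth_right
  coeff_biorth_top[OF reg] coeff_biorth_top[OF regular_flip] degree_biorth[OF reg] degree_biorth[OF regular_flip]
  coeff_biorth_0

lemma diagonal_relation:
  "(of_nat n + 1 + \<nu>) * (rb (Suc n) * r n) - t * (r (Suc n) * rb n)
    = - (\<mu> + t) - (\<Sum>j<n. rb (Suc j) * r j)"
proof -
  define S where "S = (\<Sum>j<n. rb (Suc j) * r j)"
  let ?D = "\<lambda>p :: 'a poly. pCons 0 (pderiv p)"
  have deg: "degree (?D (\<phi> n)) \<le> n" "degree (?D (\<psi> n)) \<le> n" "degree (pderiv (\<phi> n)) \<le> n"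
    using degree_euler_le[of "\<phi> n"] degree_euler_le[of "\<psi> n"] degree_pderiv_le[of "\<phi> n"]
      degree_biorth_le[of w n] degree_biorth_le[of "flip w" n] by linarith+
  have 1: "B (?D (\<phi> n)) (\<psi> n) = of_nat n * h n" "B (\<phi> n) (?D (\<psi> n)) = of_nat n * h n"
    using deg by (simp_all add: ortho_simps coeff_euler del: coeff_pCons_Suc)
  have 2: "B (\<phi> n) (\<psi> n) = h n" "B (pderiv (\<phi> n)) (\<psi> n) = 0"
    using deg by (simp_all add: ortho_simps coeff_pderiv coeff_eq_0)
  have 3: "B (pCons 0 (\<phi> n)) (\<psi> n) = - r (Suc n) * rb n * h n"
    "B (\<phi> n) (pCons 0 (\<psi> n)) = - rb (Suc n) * r n * h n"
    using reg by (simp_all add: ortho_simps toep_form_shift_left toep_form_shift_right)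
  \<comment> \<open>Subtracting \<open>n\<close> times \<open>\<psi> n\<close> kills the top
    coefficient; the next one becomes minus the subleading coefficient of \<open>\<psi> n\<close>,
    that is \<open>- S\<close>.\<close>
  define q where "q = ?D (\<psi> n) - Polynomial.smult (of_nat n) (\<psi> n)"
  have "degree (pCons 0 q) \<le> n"
  proof (rule degree_le, intro allI impI)
    fix i assume "n < i"
    then obtain j where "i = Suc j" "n \<le> j" by (cases i) auto
    then show "coeff (pCons 0 q) i = 0"
      by (cases "j = n") (simp_all add: q_def coeff_euler ortho_simps coeff_eq_0 del: coeff_pCons_Suc, simp_all add: coeff_euler ortho_simps coeff_eq_0)
  qed
  moreover have "pCons 0 (?D (\<psi> n)) = Polynomial.smult (of_nat n) (pCons 0 (\<psi> n)) + pCons 0 q"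
    by (simp add: q_def)
  moreover have "coeff (pCons 0 q) n = - S"
  proof -
    have "coeff (pCons 0 q) n = coeff (pCons 0 (?D (\<psi> n))) n - of_nat n * coeff (pCons 0 (\<psi> n)) n"
      by (cases n) (simp_all add: q_def)
    also have "\<dots> = - coeff (pCons 0 (\<psi> n)) n"
      unfolding coeff_pCons_0_euler by (simp add: algebra_simps)
    finally show ?thesis
      using coeff_biorth_subleading[OF regular_flip, of n] by (simp add: S_def)
  qed
  ultimately have 4: "B (\<phi> n) (pCons 0 (?D (\<psi> n))) = - of_nat n * (rb (Suc n) * r n) * h n - S * h n"
    by (simp only: toep_form_add_right toep_form_smult_right 3 toep_form_biorth_left) (simp add: algebra_simps)
  have "h n * ((of_nat n + 1 + \<nu>) * (rb (Suc n) * r n) - t * (r (Suc n) * rb n)) = h n * (- (\<mu> + t) - S)"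
    using pearson[OF rec, of "\<phi> n" "\<psi> n"] unfolding 1 2 3 4 by (simp add: algebra_simps)
  then show ?thesis
    using toep_norm_nonzero[OF reg, of n] unfolding S_def by simp
qed

lemma offdiagonal_relation:
  "(1 - r (Suc n) * rb (Suc n)) * (of_nat n + 1 + \<nu> + t * (r (n + 2) * rb n))
    = of_nat n + 1 - (\<Sum>j<Suc n. r (Suc j) * rb j)"
proof -
  define S where "S = (\<Sum>j<Suc n. r (Suc j) * rb j)"
  let ?D = "\<lambda>p :: 'a poly. pCons 0 (pderiv p)"
  \<comment> \<open>The multiple of \<open>\<phi> (Suc n)\<close> is orthogonal to
    \<open>\<psi> n\<close>, so only the subleading coefficient survives.\<close>
  define q where "q = ?D (\<phi> (Suc n)) - Polynomial.smult (of_nat (Suc n)) (\<phi> (Suc n))"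
  have degq: "degree q \<le> n"
  proof (rule degree_le, intro allI impI)
    fix i assume "n < i"
    then show "coeff q i = 0"
      by (cases "i = Suc n") (simp_all add: q_def coeff_euler ortho_simps coeff_eq_0 del: coeff_pCons_Suc)
  qed
  have cq: "coeff q n = - S"
    using coeff_biorth_subleading[OF reg, of "Suc n"]
    by (simp add: q_def coeff_euler S_def algebra_simps del: coeff_pCons_Suc sum.lessThan_Suc)
      (simp add: algebra_simps)
  have z: "B (\<phi> (Suc n)) (\<psi> n) = 0" "B (\<phi> (Suc n)) (?D (\<psi> n)) = 0"
    using degree_euler_le[of "\<psi> n"]
    by (simp_all add: ortho_simps coeff_eq_0 coeff_euler del: coeff_pCons_Suc)
  have "?D (\<phi> (Suc n)) = Polynomial.smult (of_nat (Suc n)) (\<phi> (Suc n)) + q"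
    by (simp add: q_def)
  then have 1: "B (?D (\<phi> (Suc n))) (\<psi> n) = - S * h n"
    using degq cq by (simp only: toep_form_add_left toep_form_smult_left z toep_form_biorth_right) simp
  have 2: "B (pderiv (\<phi> (Suc n))) (\<psi> n) = of_nat (Suc n) * h n"
    using degree_pderiv_le[of "\<phi> (Suc n)"] by (simp add: ortho_simps coeff_pderiv)
  have 3: "B (\<phi> (Suc n)) (pCons 0 (\<psi> n)) = h (Suc n)"
    "B (\<phi> (Suc n)) (pCons 0 (?D (\<psi> n))) = of_nat n * h (Suc n)"
    using degree_euler_le[of "\<psi> n"] degree_pCons_le[of 0 "\<psi> n"] degree_pCons_le[of 0 "?D (\<psi> n)"]
    by (subst toep_form_biorth_left; simp add: ortho_simps coeff_euler)+
  have 4: "B (pCons 0 (\<phi> (Suc n))) (\<psi> n) = - r (n + 2) * rb n * h (Suc n)"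
    using reg by (simp add: ortho_simps toep_form_shift_left)
  have "h (Suc n) * (of_nat n + 1 + \<nu> + t * (r (n + 2) * rb n)) = h n * (of_nat n + 1 - S)"
    using pearson[OF rec, of "\<phi> (Suc n)" "\<psi> n"] unfolding 1 2 3 4 z by (simp add: algebra_simps)
  then have "h n * ((1 - r (Suc n) * rb (Suc n)) * (of_nat n + 1 + \<nu> + t * (r (n + 2) * rb n)))
      = h n * (of_nat n + 1 - S)"
    by (simp only: toep_norm_Suc[OF reg] mult.assoc)
  then show ?thesis
    using toep_norm_nonzero[OF reg, of n] unfolding S_def by simp
qed

lemma sum_identity:
  "(of_nat n + \<nu>) * (\<Sum>j<n. rb (Suc j) * r j) - t * (\<Sum>j<n. r (Suc j) * rb j)
    = - (\<mu> + t) * of_nat n"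
proof (induction n)
  case (Suc n)
  define S T where "S = (\<Sum>j<n. rb (Suc j) * r j)" and "T = (\<Sum>j<n. r (Suc j) * rb j)"
  \<comment> \<open>Raising the prefactor by one contributes an extra \<open>S\<close>, which the
    \<open>- S\<close> of the diagonal relation cancels.\<close>
  have "(of_nat (Suc n) + \<nu>) * (S + rb (Suc n) * r n) - t * (T + r (Suc n) * rb n)
    = ((of_nat n + \<nu>) * S - t * T) + S
      + ((of_nat n + 1 + \<nu>) * (rb (Suc n) * r n) - t * (r (Suc n) * rb n))"
    by (simp add: algebra_simps)
  also have "\<dots> = - (\<mu> + t) * of_nat n + S + (- (\<mu> + t) - S)"
    unfolding diagonal_relation using Suc.IH by (simp add: S_def T_def)
  finally show ?case by (simp add: S_def T_def algebra_simps)
qed simp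

text \<open>The diagonal relation at \<open>n + 1\<close> minus that at \<open>n\<close>: the new
  summand lowers the coefficient \<open>n + 1 + \<nu>\<close> to \<open>n + \<nu>\<close>.\<close>

lemma first_recurrence:
  "(of_nat n + 2 + \<nu>) * (rb (n + 2) * r (n + 1)) - t * (r (n + 2) * rb (n + 1))
    - (of_nat n + \<nu>) * (rb (n + 1) * r n) + t * (r (n + 1) * rb n) = 0"
  (is "?l = 0")
proof -
  have "?l = ((of_nat (Suc n) + 1 + \<nu>) * (rb (Suc (Suc n)) * r (Suc n)) - t * (r (Suc (Suc n)) * rb (Suc n)))
    - ((of_nat n + 1 + \<nu>) * (rb (Suc n) * r n) - t * (r (Suc n) * rb n)) + rb (Suc n) * r n"
    by (simp add: algebra_simps)
  also have "\<dots> = 0"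
    unfolding diagonal_relation by simp
  finally show ?thesis .
qed

lemma second_recurrence:
  "(1 - r (n + 2) * rb (n + 2)) * (of_nat n + 2 + \<nu> + t * (r (n + 3) * rb (n + 1)))
    - (1 - r (n + 1) * rb (n + 1)) * (of_nat n + 1 + \<nu> + t * (r (n + 2) * rb n))
    + r (n + 2) * rb (n + 1) = 1"
  (is "?l = 1")
proof -
  have "?l = (1 - r (Suc (Suc n)) * rb (Suc (Suc n)))
        * (of_nat (Suc n) + 1 + \<nu> + t * (r (Suc n + 2) * rb (Suc n)))
      - (1 - r (Suc n) * rb (Suc n)) * (of_nat n + 1 + \<nu> + t * (r (n + 2) * rb n))
      + r (Suc (Suc n)) * rb (Suc n)"
    by (simp add: numeral_3_eq_3 add.commute)
  also have "\<dots> = 1"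
    unfolding offdiagonal_relation by simp
  finally show ?thesis .
qed

end

section \<open>The Fourier coefficients of the weight\<close>

lemma cis_minus_pi: "cis (- pi) = - 1"
  by (simp add: complex_eq_iff)

text \<open>Keeps both principal powers off their branch cut on the open arc.\<close>

lemma one_plus_cis_notin_nonpos:
  assumes "- pi < x" "x < pi"
  shows "1 + cis x \<notin> \<real>\<^sub>\<le>\<^sub>0"
proof
  assume "1 + cis x \<in> \<real>\<^sub>\<le>\<^sub>0"
  then have s: "sin x = 0" and c: "cos x \<le> -1"
    by (auto simp: complex_nonpos_Reals_iff)
  have "x = 0"
    using s assms sin_gt_zero[of x] sin_gt_zero[of "- x"] by (cases x "0::real" rule: linorder_cases) auto
  with c show False by simp
qed

text \<open>The extra factor \<open>1 + z\<close> makes the Fourier integrand continuous on the closed interval. It vanishes at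
  both ends, and integrating its derivative gives the recurrence. Since all other terms are continuous,
  this also yields integrability of the weight.\<close>
definition symbol_primitive :: "complex \<Rightarrow> complex \<Rightarrow> complex \<Rightarrow> int \<Rightarrow> real \<Rightarrow> complex" where
  "symbol_primitive \<mu> \<nu> t k x = (1 + cis x) * (circle_weight \<mu> \<nu> t (cis x) * cis (- (of_int k * x)))"

lemma cis_shift:
  "cis x * cis (- (of_int k * x)) = cis (- (of_int (k - 1) * x))"
  by (simp add: cis_mult algebra_simps)

text \<open>The factor \<open>1 + z\<close> clears the denominators \<open>1 + z\<close> and
  \<open>1 + 1/z\<close> produced by the two powers. The result is arranged so that only its last
  term can be singular at the endpoints.\<close>

lemma symbol_primitive_has_derivative:
  assumes "- pi < x" "x < pi"
  shows "(symbol_primitive \<mu> \<nu> t k has_vector_derivative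
    \<i> * ((1 + \<mu> - of_int k) * symbol_primitive \<mu> \<nu> t k x + t * symbol_primitive \<mu> \<nu> t (k - 1) x
      - (1 + \<mu> + \<nu>) * (circle_weight \<mu> \<nu> t (cis x) * cis (- (of_int k * x))))) (at x)"
proof -
  define F where "F z = (1 + exp (\<i> * z)) * ((1 + exp (\<i> * z)) powr \<mu> * (1 + exp (- (\<i> * z))) powr \<nu>
    * exp (t * exp (\<i> * z)) * exp (- (\<i> * of_int k * z)))" for z
  have cis: "cis y = exp (\<i> * of_real y)" for y by (simp add: cis_conv_exp)
  have F: "symbol_primitive \<mu> \<nu> t k = F \<circ> of_real"
    by (rule ext) (simp add: symbol_primitive_def F_def circle_weight_def cis exp_minus inverse_eq_divide mult_ac)
  define z where "z = exp (\<i> * of_real x)"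
  have "1 + z \<notin> \<real>\<^sub>\<le>\<^sub>0"
    using one_plus_cis_notin_nonpos[OF assms] by (simp add: z_def cis)
  moreover have zi: "exp (- (\<i> * of_real x)) = inverse z"
    by (simp add: z_def exp_minus)
  moreover have "1 + inverse z \<notin> \<real>\<^sub>\<le>\<^sub>0"
    using one_plus_cis_notin_nonpos[of "- x"] assms by (simp add: zi[symmetric] cis)
  ultimately have nz: "1 + z \<noteq> 0" "1 + inverse z \<noteq> 0" "z \<noteq> 0" and
    np: "1 + z \<notin> \<real>\<^sub>\<le>\<^sub>0" "1 + inverse z \<notin> \<real>\<^sub>\<le>\<^sub>0"
    by (auto simp: z_def)
  define P Q E K where "P = (1 + z) powr \<mu>" and "Q = (1 + inverse z) powr \<nu>" and "E = exp (t * z)"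
    and "K = exp (- (\<i> * of_int k * of_real x))"
  have "(F has_field_derivative
      \<i> * z * (P * Q * E * K)
      + (1 + z) * (\<mu> * (\<i> * z) * P / (1 + z) * Q * E * K
        + P * (\<nu> * (- (\<i> * inverse z)) * Q / (1 + inverse z)) * E * K
        + P * Q * (t * (\<i> * z) * E) * K + P * Q * E * (- (\<i> * of_int k) * K))) (at (of_real x))"
    unfolding F_def
    apply (rule derivative_eq_intros refl | simp add: zi z_def[symmetric] np)+
    apply (simp add: zi z_def[symmetric] P_def[symmetric] Q_def[symmetric] E_def[symmetric] K_def[symmetric]
      powr_diff nz)
    apply (simp add: divide_inverse algebra_simps)
    done
  note D = has_vector_derivative_real_field[OF this]
  define W where "W = P * Q * E * K"
  have W: "circle_weight \<mu> \<nu> t (cis x) * cis (- (of_int k * x)) = W"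
    unfolding W_def P_def Q_def E_def K_def
    by (simp add: circle_weight_def cis z_def inverse_eq_divide mult_ac)
  have S: "symbol_primitive \<mu> \<nu> t k x = (1 + z) * W"
    unfolding symbol_primitive_def W by (simp add: z_def cis)
  have S': "symbol_primitive \<mu> \<nu> t (k - 1) x = (1 + z) * (z * W)"
    unfolding symbol_primitive_def cis_shift[symmetric] W[symmetric] by (simp add: z_def cis)
  have p: "(1 + z) / (1 + z) = 1"
    using nz by simp
  have q: "(1 + z) * inverse z / (1 + inverse z) = 1"
    using nz by (simp add: field_simps)
  have "\<i> * z * (P * Q * E * K)
      + (1 + z) * (\<mu> * (\<i> * z) * P / (1 + z) * Q * E * K
        + P * (\<nu> * (- (\<i> * inverse z)) * Q / (1 + inverse z)) * E * K
        + P * Q * (t * (\<i> * z) * E) * K + P * Q * E * (- (\<i> * of_int k) * K))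
    = \<i> * (z * W + \<mu> * z * W * ((1 + z) / (1 + z))
        - \<nu> * W * ((1 + z) * inverse z / (1 + inverse z)) + (1 + z) * (t * z - of_int k) * W)"
  proof -
    define c d where "c = inverse (1 + z)" and "d = inverse (1 + inverse z)"
    show ?thesis
      unfolding W_def divide_inverse c_def[symmetric] d_def[symmetric] by (simp add: algebra_simps)
  qed
  also have "\<dots> = \<i> * ((1 + \<mu> - of_int k) * ((1 + z) * W) + t * ((1 + z) * (z * W)) - (1 + \<mu> + \<nu>) * W)"
    unfolding p q by (simp add: algebra_simps)
  finally have eq: "\<i> * z * (P * Q * E * K)
      + (1 + z) * (\<mu> * (\<i> * z) * P / (1 + z) * Q * E * K
        + P * (\<nu> * (- (\<i> * inverse z)) * Q / (1 + inverse z)) * E * K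
        + P * Q * (t * (\<i> * z) * E) * K + P * Q * E * (- (\<i> * of_int k) * K))
    = \<i> * ((1 + \<mu> - of_int k) * ((1 + z) * W) + t * ((1 + z) * (z * W)) - (1 + \<mu> + \<nu>) * W)" .
  show ?thesis
    unfolding W S S' unfolding F o_def by (rule D[unfolded eq])
qed

lemma continuous_on_symbol_primitive:
  assumes "Re (\<mu> + \<nu>) > - 1"
  shows "continuous_on {- pi..pi} (symbol_primitive \<mu> \<nu> t k)"
proof -
  define m where "m x = (1 + cis x) * of_real (cmod (1 + cis x)) powr (\<mu> + \<nu>)" for x
  define G where "G x = exp (\<i> * of_real x * (\<mu> - \<nu>) / 2)
      * m x * exp (t * cis x)
      * cis (- (of_int k * x))" for x
  have nz: "1 + cis x = 0" if "x = pi \<or> x = - pi" for x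
    using that by (auto simp: cis_minus_pi)
  have "symbol_primitive \<mu> \<nu> t k x = G x" if "x \<in> {- pi..pi}" for x
  proof (cases "x = pi \<or> x = - pi")
    case True
    then show ?thesis by (simp add: symbol_primitive_def G_def m_def nz)
  next
    case False
    with that have "- pi < x" "x \<le> pi" by auto
    then show ?thesis
      by (simp add: symbol_primitive_def G_def m_def circle_weight_cis mult_ac)
  qed
  moreover have "continuous_on UNIV (\<lambda>z::complex. z * of_real (cmod z) powr (\<mu> + \<nu>))"
  proof (rule continuous_at_imp_continuous_on, intro ballI)
    fix z :: complex
    show "isCont (\<lambda>z::complex. z * of_real (cmod z) powr (\<mu> + \<nu>)) z"
    proof (cases "z = 0")
      case False
      then have "complex_of_real (cmod z) \<notin> \<real>\<^sub>\<le>\<^sub>0" by (simp add: complex_nonpos_Reals_iff)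
      then show ?thesis by (intro continuous_intros) auto
    next
      case True
      \<comment> \<open>This is the modulus of the function in question; the exponent is positive by
        the assumption on \<mu> + \<nu>.\<close>
      have "((\<lambda>z::complex. cmod z powr (1 + Re (\<mu> + \<nu>))) \<longlongrightarrow> 0) (at 0)"
        using assms by (auto intro!: tendsto_eq_intros tendsto_zero_powrI)
      then have "((\<lambda>z::complex. z * of_real (cmod z) powr (\<mu> + \<nu>)) \<longlongrightarrow> 0) (at 0)"
        by (rule Lim_null_comparison[rotated])
          (auto intro!: eventuallyI simp: norm_mult norm_powr_real_powr powr_add)
      then show ?thesis by (simp add: True isCont_def)
    qed
  qed
  then have "continuous_on {- pi..pi} m"
    unfolding m_def by (rule continuous_on_compose2) (auto intro!: continuous_intros)
  then have "continuous_on {- pi..pi} G"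
    unfolding G_def by (intro continuous_intros) auto
  ultimately show ?thesis by (subst continuous_on_cong[OF refl, of _ _ G]) auto
qed

lemma fourier_coeff_circle_weight_rec:
  fixes \<mu> \<nu> t :: complex
  assumes "Re (\<mu> + \<nu>) > - 1"
  defines "c \<equiv> fourier_coeff (circle_weight \<mu> \<nu> t)"
  shows "(of_int k + \<nu>) * c k + (of_int k - 1 - \<mu> - t) * c (k - 1) - t * c (k - 2) = 0"
proof -
  let ?I = "{- pi..pi}"
  let ?S = "symbol_primitive \<mu> \<nu> t"
  define g where "g k x = circle_weight \<mu> \<nu> t (cis x) * cis (- (of_int k * x))" for k x
  have c: "c k = 1 / (2 * of_real pi) * integral ?I (g k)" for k
    unfolding c_def fourier_coeff_def g_def by (simp add: cis_conv_exp mult_ac)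
  have S: "?S k x = g k x + g (k - 1) x" for k x
    unfolding symbol_primitive_def g_def cis_shift[symmetric] by (simp add: algebra_simps)
  have ends: "?S k pi = 0" "?S k (- pi) = 0" for k
    by (simp_all add: symbol_primitive_def cis_minus_pi)
  have Sint: "?S k integrable_on ?I" for k
    by (intro integrable_continuous_real continuous_on_symbol_primitive assms)
  have D: "((\<lambda>x. \<i> * ((1 + \<mu> - of_int k) * ?S k x + t * ?S (k - 1) x - (1 + \<mu> + \<nu>) * g k x)) has_integral 0) ?I" for k
  proof -
    have "((\<lambda>x. \<i> * ((1 + \<mu> - of_int k) * ?S k x + t * ?S (k - 1) x - (1 + \<mu> + \<nu>) * g k x))
      has_integral ?S k pi - ?S k (- pi)) ?I"
      unfolding g_def
      by (rule fundamental_theorem_of_calculus_interior)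
        (auto intro!: continuous_on_symbol_primitive assms symbol_primitive_has_derivative)
    then show ?thesis by (simp add: ends)
  qed
  have D': "((\<lambda>x. (1 + \<mu> - of_int k) * ?S k x + t * ?S (k - 1) x - (1 + \<mu> + \<nu>) * g k x) has_integral 0) ?I" for k
    using has_integral_mult_right[OF D[of k], of "- \<i>"] by (simp add: mult.assoc[symmetric])
  have nz: "1 + \<mu> + \<nu> \<noteq> 0"
  proof
    assume "1 + \<mu> + \<nu> = 0"
    then have "Re (1 + \<mu> + \<nu>) = 0" by simp
    with assms show False by simp
  qed
  have gint: "g k integrable_on ?I" for k
  proof -
    \<comment> \<open>Solves the derivative formula for \<open>g k\<close>: the derivative is
      integrable by the fundamental theorem, the other terms by continuity.\<close>
    have "(\<lambda>x. inverse (1 + \<mu> + \<nu>) * (((1 + \<mu> - of_int k) * ?S k x + t * ?S (k - 1) x)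
      - ((1 + \<mu> - of_int k) * ?S k x + t * ?S (k - 1) x - (1 + \<mu> + \<nu>) * g k x))) integrable_on ?I"
      by (intro integrable_on_mult_right integrable_diff integrable_add Sint has_integral_integrable[OF D'])
    then show ?thesis using nz by (simp add: mult.assoc[symmetric])
  qed
  define J where "J k = integral ?I (g k)" for k
  have Jint: "(g k has_integral J k) ?I" for k
    unfolding J_def by (rule integrable_integral[OF gint])
  \<comment> \<open>Splitting each primitive as \<open>g k + g (k - 1)\<close> evaluates the same
    integral in terms of \<open>J\<close>; equating it to 0 gives the recurrence.\<close>
  have "((\<lambda>x. (1 + \<mu> - of_int k) * ?S k x + t * ?S (k - 1) x - (1 + \<mu> + \<nu>) * g k x)
    has_integral ((1 + \<mu> - of_int k) * (J k + J (k - 1)) + t * (J (k - 1) + J (k - 1 - 1)) - (1 + \<mu> + \<nu>) * J k)) ?I"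
    unfolding S by (intro has_integral_diff has_integral_add has_integral_mult_right Jint)
  from has_integral_unique[OF this D']
  have "(of_int k + \<nu>) * J k + (of_int k - 1 - \<mu> - t) * J (k - 1) - t * J (k - 2) = 0"
    by (simp add: algebra_simps)
  moreover have "(of_int k + \<nu>) * c k + (of_int k - 1 - \<mu> - t) * c (k - 1) - t * c (k - 2)
    = 1 / (2 * of_real pi)
      * ((of_int k + \<nu>) * J k + (of_int k - 1 - \<mu> - t) * J (k - 1) - t * J (k - 2))"
    unfolding c J_def[symmetric] by (simp only: ring_distribs mult_ac)
  ultimately show ?thesis by simp
qed

section \<open>Reflection coefficients\<close>

lemma toeplitz_det_eq: "toeplitz_det w e n = Determinant.det (toep_mat (fourier_coeff w) e n)"
  by (simp add: toeplitz_det_def toep_mat_def)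

lemma refl_coeff_eq: "refl_coeff w = szego_coeff (fourier_coeff w)"
  by (rule ext) (simp add: refl_coeff_def szego_coeff_def toeplitz_det_eq)

lemma refl_coeff_bar_eq: "refl_coeff_bar w = szego_coeff (flip (fourier_coeff w))"
  by (rule ext) (simp add: refl_coeff_bar_def szego_coeff_def toeplitz_det_eq det_toep_mat_flip)

theorem mainTheorem7:
  fixes \<mu> \<nu> t :: complex and w :: "complex \<Rightarrow> complex" and r rbar v :: "nat \<Rightarrow> complex"
  assumes "Re (\<mu> + \<nu>) > - 1"
    and "w = circle_weight \<mu> \<nu> t"
    and "\<And>N. N \<ge> 1 \<Longrightarrow> toeplitz_det w 0 N \<noteq> 0"
    and "r = refl_coeff w"
    and "rbar = refl_coeff_bar w"
    and "\<And>N. v N = 1 - r N * rbar N"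
  shows "\<forall>N\<ge>1.
      (of_nat N + \<nu>) * (\<Sum>j<N. rbar (j + 1) * r j) - t * (\<Sum>j<N. r (j + 1) * rbar j)
        = - (\<mu> + t) * of_nat N
    \<and> - t * r (N + 1) * rbar N + t * r N * rbar (N - 1)
        + (of_nat N + 1 + \<nu>) * r N * rbar (N + 1)
        - (of_nat N - 1 + \<nu>) * r (N - 1) * rbar N = 0
    \<and> v (N + 1) * (of_nat N + 1 + \<nu> + t * r (N + 2) * rbar N)
        - v N * (of_nat N + \<nu> + t * r (N + 1) * rbar (N - 1)) + r (N + 1) * rbar N = 1"
proof (intro allI impI)
  fix N :: nat assume "N \<ge> 1"
  then obtain n where N: "N = Suc n" by (cases N) auto
  have "regular_symbol (fourier_coeff w)"
    unfolding regular_symbol_def toeplitz_det_eq[symmetric]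
  proof
    \<comment> \<open>The hypothesis starts at order 1; the determinant of order 0 is 1.\<close>
    fix m show "toeplitz_det w 0 m \<noteq> 0"
      using assms(3)[of m] by (cases m) (simp_all add: toeplitz_det_0)
  qed
  then interpret S: semiclassical_symbol "fourier_coeff w" \<mu> \<nu> t
    using fourier_coeff_circle_weight_rec[OF assms(1)] by unfold_locales (simp_all add: assms(2))
  note r = assms(4)[unfolded refl_coeff_eq] and rbar = assms(5)[unfolded refl_coeff_bar_eq]
  have "(of_nat N + \<nu>) * (\<Sum>j<N. rbar (j + 1) * r j) - t * (\<Sum>j<N. r (j + 1) * rbar j)
        = - (\<mu> + t) * of_nat N"
    using S.sum_identity[of N] by (simp add: r rbar)
  moreover have "- t * r (N + 1) * rbar N + t * r N * rbar (N - 1)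
        + (of_nat N + 1 + \<nu>) * r N * rbar (N + 1)
        - (of_nat N - 1 + \<nu>) * r (N - 1) * rbar N = 0"
    using S.first_recurrence[of n] by (simp add: r rbar N algebra_simps)
  moreover have "v (N + 1) * (of_nat N + 1 + \<nu> + t * r (N + 2) * rbar N)
        - v N * (of_nat N + \<nu> + t * r (N + 1) * rbar (N - 1)) + r (N + 1) * rbar N = 1"
    using S.second_recurrence[of n] by (simp add: assms(6) r rbar N numeral_3_eq_3 mult.assoc add_ac)
  ultimately show "(of_nat N + \<nu>) * (\<Sum>j<N. rbar (j + 1) * r j) - t * (\<Sum>j<N. r (j + 1) * rbar j)
        = - (\<mu> + t) * of_nat N
    \<and> - t * r (N + 1) * rbar N + t * r N * rbar (N - 1)
        + (of_nat N + 1 + \<nu>) * r N * rbar (N + 1)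
        - (of_nat N - 1 + \<nu>) * r (N - 1) * rbar N = 0
    \<and> v (N + 1) * (of_nat N + 1 + \<nu> + t * r (N + 2) * rbar N)
        - v N * (of_nat N + \<nu> + t * r (N + 1) * rbar (N - 1)) + r (N + 1) * rbar N = 1"
    by blast
qed

end
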